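(* With the setting and notation of the context (with $m=\tfrac{q(q+1)}2$), let $\mathbf U_{(2)}^*=[\boldsymbol\varphi_{q+1}^*,\dots,\boldsymbol\varphi_{q+m}^*]\in\mathbb R^{\mathcal M\times m}$ be the matrix of the first $m$ left singular vectors of $(\mathbf I-\Pi_0)\mathbf Q_0$. Then the limit coefficients $\boldsymbol\alpha_{(2)}^*(\boldsymbol\nu):=\mathbf U_{(2)}^{*\top}\mathbf v(\boldsymbol\nu)\in\mathbb R^m$ satisfy, as $\boldsymbol\nu\to\boldsymbol 0$, \[ \boldsymbol\alpha_{(2)}^*(\boldsymbol\nu)=\mathbf R\,\mathrm{vecsym}\Big(\big((\mathbf A^* )^{-1}\boldsymbol\alpha_{(1)}^*(\boldsymbol\nu)\big)\big((\mathbf A^* )^{-1}\boldsymbol\alpha_{(1)}^*(\boldsymbol\nu)\big)^\top\Big)+\mathcal O\big(\|\boldsymbol\alpha_{(1)}^*(\boldsymbol\nu)\|^3\big), \] where $\boldsymbol\alpha_{(1)}^*(\boldsymbol\nu)=\mathbf U_{(1)}^{*\top}\mathbf v(\boldsymbol\nu)$, $\mathbf A^*=\mathbf U_{(1)}^{*\top}\mathbf J_U(\boldsymbol 0)$, and $\mathbf R\in\mathbb R^{m\times m}$ is defined, for $(j,\ell)\in\mathcal I$ and $k=1,\dots,m$, by \[ \mathbf R_{k,(j,\ell)}=\tfrac12(2-\delta_{j\ell})\big\langle\boldsymbol\varphi_{q+k}^*,(\mathbf I-\Pi_0)\,\partial_{\nu_j}\partial_{\nu_\ell}U(\boldsymbol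 0)\big\rangle . \]
   Context: Setting. $\mathcal S$ is an embedded submanifold of dimension $q$ of $\mathbb R^{\mathcal M}$ ($\mathcal M\gg q$), and $\mathbf u^*\in\mathcal S$. $U:\mathcal Q^0\to\mathbb R^{\mathcal M}$ is the inverse of a chart of $\mathcal S$ around $\mathbf u^*$: $\mathcal Q^0\subset\mathbb R^q$ is open and contains the unit ball $\mathcal B(\boldsymbol 0,1)$, $U$ is a homeomorphism onto an open subset of $\mathcal S$, and $U(\boldsymbol 0)=\mathbf u^*$. Put $\mathbf v(\boldsymbol\nu)=U(\boldsymbol\nu)-\mathbf u^*$. Standing assumptions: $U$ is of class $C^3$; at every point of $\mathcal Q^0$ the Jacobian $\mathbf J_U(\boldsymbol\nu)\in\mathbb R^{\mathcal M\times q}$ has rank $q$, and the second fundamental form has maximal rank, i.e. the components of the second derivatives $\partial_{\nu_j}\partial_{\nu_\ell}U$, $1\le j\le\ell\le q$, orthogonal to the tangent space $\mathrm{Range}(\mathbf J_U(\boldsymbol\nu))$ span a space of dimension $\tfrac12q(q+1)$. Sampling. $\boldsymbol\nu^1,\dots,\boldsymbol\nu^M\in\mathcal B(\boldsymbol 0,1)$ are fixed points such that $\mathbf P=[\boldsymbol\nu^1,\dots,\boldsymbol\nu^M]\in\mathbb R^{q\times M}$ has rank $q$. Let $\mathcal I=\{(j,\ell):1\le j\le\ell\le q\}$, $m=|\mathcal I|=\tfrac{q(q+1)}2$. For a symmetric $q\times q$ matrix $\mathbf A=(a_{ij})$, $\mathrm{vecsym}(\mathbf A)\in\mathbb R^m$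 is the vector of its upper triangular entries, row by row: $(a_{11},a_{12},\dots,a_{1q},a_{22},\dots,a_{2q},\dots,a_{qq})^\top$; $\mathcal I$ is ordered accordingly. The matrix $\mathbf P_2=[\mathrm{vecsym}(\boldsymbol\nu^1\boldsymbol\nu^{1\top}),\dots,\mathrm{vecsym}(\boldsymbol\nu^M\boldsymbol\nu^{M\top})]\in\mathbb R^{m\times M}$ is assumed to have rank $m$. First-order block. $\mathbf U_{(1)}^*\in\mathbb R^{\mathcal M\times q}$ is the matrix of the first $q$ (orthonormal) left singular vectors of $\mathbf J_U(\boldsymbol 0)\mathbf P$; its range is the tangent space $\mathrm{Range}(\mathbf J_U(\boldsymbol 0))$. $\Pi_0=\mathbf U_{(1)}^*\mathbf U_{(1)}^{*\top}$ is the orthogonal projection onto the tangent space, and $\mathbf A^*\in\mathbb R^{q\times q}$ is invertible. Second-order block. $\mathbf Q_{\mathrm{base}}=[(2-\delta_{j\ell})\,\partial_{\nu_j}\partial_{\nu_\ell}U(\boldsymbol 0)]_{(j,\ell)\in\mathcal I}\in\mathbb R^{\mathcal M\times m}$ ($\delta_{j\ell}$ the Kronecker symbol) and $\mathbf Q_0=\mathbf Q_{\mathrm{base}}\mathbf P_2\in\mathbb R^{\mathcal M\times M}$, whose $i$-th column is $D^2U(\boldsymbol 0)[\boldsymbol\nu^i,\boldsymbol\nu^i]$. The matrix $(\mathbf I-\Pi_0)\mathbf Q_{\mathrm{base}}$ has rank $m$. *)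

theory Defs
  imports "HOL-Analysis.Analysis" "HOL-Library.Landau_Symbols"
begin

section \<open>Partial derivatives and functions of class C^k\<close>

definition partial_deriv :: "'q::finite \<Rightarrow> (real^'q \<Rightarrow> 'b::real_normed_vector) \<Rightarrow> real^'q \<Rightarrow> 'b" where
  "partial_deriv j f x = frechet_derivative f (at x) (axis j 1)"

text \<open>Meaningful for open \<open>S\<close> only.\<close>
primrec C_k_on :: "nat \<Rightarrow> (real^'q::finite \<Rightarrow> 'b::real_normed_vector) \<Rightarrow> (real^'q) set \<Rightarrow> bool" where
  "C_k_on 0 f S \<longleftrightarrow> continuous_on S f"
| "C_k_on (Suc k) f S \<longleftrightarrow> f differentiable_on S \<and> (\<forall>j. C_k_on k (partial_deriv j f) S)"

section \<open>Embedded submanifolds\<close>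

text \<open>\<open>S\<close> is a \<open>d\<close>-dimensional embedded submanifold of class C^k: near each of its points, a C^k
  diffeomorphism \<open>\<Phi>\<close> (with inverse \<open>\<Psi>\<close>) of an open set \<open>V\<close> flattens \<open>S\<close> to a \<open>d\<close>-dimensional
  linear subspace.\<close>
definition embedded_submanifold :: "nat \<Rightarrow> nat \<Rightarrow> (real^'n::finite) set \<Rightarrow> bool" where
  "embedded_submanifold k d S \<longleftrightarrow>
     (\<forall>p\<in>S. \<exists>V (\<Phi> :: real^'n \<Rightarrow> real^'n) \<Psi> L.
        open V \<and> p \<in> V \<and> open (\<Phi> ` V) \<and> C_k_on k \<Phi> V \<and> C_k_on k \<Psi> (\<Phi> ` V) \<and>
        (\<forall>x\<in>V. \<Psi> (\<Phi> x) = x) \<and>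
        subspace L \<and> dim L = d \<and> \<Phi> ` (V \<inter> S) = \<Phi> ` V \<inter> L)"

text \<open>The component of \<open>x\<close> orthogonal to the subspace \<open>T\<close>.\<close>
definition normal_component :: "('b::euclidean_space) set \<Rightarrow> 'b \<Rightarrow> 'b" where
  "normal_component T x = (THE z. (\<forall>t\<in>T. orthogonal z t) \<and> x - z \<in> T)"

section \<open>Singular vectors\<close>

definition outer :: "real^'a::finite \<Rightarrow> real^'b::finite \<Rightarrow> real^'b^'a" where
  "outer x y = (\<chi> i j. x $ i * y $ j)"

definition orthonormal_family :: "nat \<Rightarrow> (nat \<Rightarrow> 'b::real_inner) \<Rightarrow> bool" where
  "orthonormal_family d u \<longleftrightarrow> (\<forall>k<d. \<forall>l<d. u k \<bullet> u l = (if k = l then 1 else 0))"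

text \<open>A full singular value decomposition: \<open>u\<close> and \<open>v\<close> list the columns of the two orthogonal
  matrices, \<open>\<sigma>\<close> the singular values in non-increasing order.\<close>
definition is_svd ::
  "real^'s::finite^'n::finite \<Rightarrow> (nat \<Rightarrow> real^'n) \<Rightarrow> (nat \<Rightarrow> real) \<Rightarrow> (nat \<Rightarrow> real^'s) \<Rightarrow> bool" where
  "is_svd A u \<sigma> v \<longleftrightarrow>
     orthonormal_family CARD('n) u \<and> orthonormal_family CARD('s) v \<and>
     (\<forall>k < min CARD('n) CARD('s). 0 \<le> \<sigma> k) \<and>
     (\<forall>k l. k \<le> l \<and> l < min CARD('n) CARD('s) \<longrightarrow> \<sigma> l \<le> \<sigma> k) \<and>
     A = (\<Sum>k < min CARD('n) CARD('s). \<sigma> k *\<^sub>R outer (u k) (v k))"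

text \<open>Singular vectors are not unique, hence a predicate.  The number of columns of \<open>W\<close> is
  \<open>CARD('r)\<close>; the linear order on \<open>'r\<close> enumerates them, so that the column \<open>k\<close> is preceded by
  \<open>card {l. l < k}\<close> columns.\<close>
definition first_left_singular_vectors ::
  "real^'s::finite^'n::finite \<Rightarrow> real^('r::{finite,linorder})^'n \<Rightarrow> bool" where
  "first_left_singular_vectors A W \<longleftrightarrow>
     CARD('r) \<le> CARD('n) \<and>
     (\<exists>u \<sigma> v. is_svd A u \<sigma> v \<and> (\<forall>k. column k W = u (card {l. l < k})))"

section \<open>Vectorized symmetric matrices\<close>

text \<open>The index set of all \<open>(j, l)\<close> with \<open>j \<le> l\<close>, as a type.  Vectors and matrices are indexed by
  these pairs themselves instead of by their positions in the row-by-row enumeration.\<close>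
typedef (overloaded) 'q symidx = "{(j, l). j \<le> l} :: ('q::{finite,linorder} \<times> 'q) set"
  morphisms pair_of Abs_symidx
  by auto

instance symidx :: ("{finite,linorder}") finite
proof
  have "inj (pair_of :: 'a symidx \<Rightarrow> _)"
    by (rule injI) (simp add: pair_of_inject)
  then show "finite (UNIV :: 'a symidx set)"
    by (rule inj_on_finite[where B = UNIV]) (rule subset_UNIV, rule finite)
qed

abbreviation row_of :: "'q::{finite,linorder} symidx \<Rightarrow> 'q" where
  "row_of p \<equiv> fst (pair_of p)"

abbreviation col_of :: "'q::{finite,linorder} symidx \<Rightarrow> 'q" where
  "col_of p \<equiv> snd (pair_of p)"

definition vecsym :: "real^('q::{finite,linorder})^('q::{finite,linorder}) \<Rightarrow> real^('q symidx)" where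
  "vecsym A = (\<chi> p. A $ row_of p $ col_of p)"

text \<open>The factor \<open>2 - \<delta>\<close>.\<close>
definition sym_weight :: "'q::{finite,linorder} symidx \<Rightarrow> real" where
  "sym_weight p = 2 - (if row_of p = col_of p then 1 else 0)"

definition second_partial ::
  "(real^('q::{finite,linorder}) \<Rightarrow> real^'n) \<Rightarrow> 'q symidx
     \<Rightarrow> real^('q::{finite,linorder}) \<Rightarrow> real^'n" where
  "second_partial U p = partial_deriv (row_of p) (partial_deriv (col_of p) U)"

section \<open>The matrices of the first- and second-order blocks\<close>

definition P_mat :: "('s \<Rightarrow> real^'q) \<Rightarrow> real^'s::finite^'q::finite" where
  "P_mat \<nu>s = (\<chi> j i. \<nu>s i $ j)"

definition P2_mat :: "('s \<Rightarrow> real^('q::{finite,linorder})) \<Rightarrow> real^'s::finite^('q symidx)" where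
  "P2_mat \<nu>s = (\<chi> p i. vecsym (outer (\<nu>s i) (\<nu>s i)) $ p)"

definition Qbase_mat ::
  "(real^('q::{finite,linorder}) \<Rightarrow> real^'n) \<Rightarrow> real^('q symidx)^'n" where
  "Qbase_mat U = (\<chi> a p. sym_weight p * second_partial U p 0 $ a)"

text \<open>Here \<open>Pi0\<close> is the orthogonal projection onto the tangent space and the columns of \<open>U2\<close> are
  the second-order modes.\<close>
definition R_mat ::
  "(real^('q::{finite,linorder}) \<Rightarrow> real^'n) \<Rightarrow> real^'n^'n \<Rightarrow> real^'m^'n
     \<Rightarrow> real^('q symidx)^'m::finite" where
  "R_mat U Pi0 U2 =
     (\<chi> k p. 1/2 * sym_weight p * (column k U2 \<bullet> ((mat 1 - Pi0) *v second_partial U p 0)))"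

end

theory Submission
  imports Defs
begin

text \<open>
  Write \<open>J\<close> for the Jacobian of \<open>U\<close> at \<open>0\<close> and \<open>s h\<close> for the vectorized matrix \<open>h h\<^sup>T\<close>.  Taylor's theorem for
  the \<open>C\<^sup>3\<close> map \<open>U\<close> gives \<open>v h = J h + G (s h) + O(norm h ^ 3)\<close>, where \<open>G\<close> is half of \<open>Qbase_mat U\<close>
  (\<open>taylor_order_two\<close>; the factor \<open>2 - \<delta>\<close> in \<open>Qbase_mat\<close> folds the full double sum of second
  derivatives onto the pairs \<open>j \<le> l\<close>, which requires that mixed partial derivatives commute).

  The two families of modes see different parts of this expansion.  The matrix \<open>J P\<close> has exactly \<open>q\<close>
  nonzero singular values, so its first \<open>q\<close> left singular vectors span the tangent space: \<open>U1\<close>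
  inverts the linear part, that is \<open>inverse A (\<alpha>1 h) = h + O(norm h ^ 2)\<close>, and \<open>norm h\<close> and
  \<open>norm (\<alpha>1 h)\<close> are comparable near \<open>0\<close>.  Likewise the maximal rank of the second fundamental form
  and of \<open>P2\<close> make \<open>(I - \<Pi>) Q\<close> a matrix of rank exactly \<open>m\<close>; hence the columns of \<open>U2\<close> lie in its
  range and are normal to the manifold, and \<open>U2\<^sup>T J = 0\<close>.  Both facts about singular vectors are
  instances of \<open>range_first_left_singular_vectors\<close>.

  Applying \<open>U2\<^sup>T\<close> to the expansion thus leaves \<open>\<alpha>2 h = R (s h) + O(norm h ^ 3)\<close>.  Replacing \<open>h\<close> by
  \<open>inverse A (\<alpha>1 h)\<close>, which differs from it by \<open>O(norm h ^ 2)\<close>, changes the quadratic expression \<open>s h\<close>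
  only by \<open>O(norm h ^ 3)\<close>; this last step is \<open>quadratic_closure\<close>.
\<close>

section \<open>Taylor expansion of order two in several variables\<close>

lemma has_derivative_partial_deriv:
  assumes "f differentiable (at x)"
  shows "(f has_derivative (\<lambda>h. \<Sum>j\<in>UNIV. h $ j *\<^sub>R partial_deriv j f x)) (at x)"
proof -
  have D: "(f has_derivative frechet_derivative f (at x)) (at x)"
    using assms by (simp add: frechet_derivative_works)
  then have lin: "linear (frechet_derivative f (at x))"
    by (rule has_derivative_linear)
  have "frechet_derivative f (at x) h = (\<Sum>j\<in>UNIV. h $ j *\<^sub>R partial_deriv j f x)" for h
  proof -
    have "frechet_derivative f (at x) h
        = frechet_derivative f (at x) (\<Sum>j\<in>UNIV. h $ j *s axis j 1)"
      by (simp only: basis_expansion)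
    also have "\<dots> = (\<Sum>j\<in>UNIV. h $ j *\<^sub>R partial_deriv j f x)"
      by (simp add: linear_sum[OF lin] scalar_mult_eq_scaleR linear_scale[OF lin] partial_deriv_def)
    finally show ?thesis .
  qed
  then have "frechet_derivative f (at x) = (\<lambda>h. \<Sum>j\<in>UNIV. h $ j *\<^sub>R partial_deriv j f x)"
    by (rule ext)
  with D show ?thesis by (simp only:)
qed

lemma C_k_on_SucD:
  assumes "C_k_on (Suc k) f S" "open S" "x \<in> S"
  shows "(f has_derivative (\<lambda>h. \<Sum>j\<in>UNIV. h $ j *\<^sub>R partial_deriv j f x)) (at x)"
proof (rule has_derivative_partial_deriv)
  from assms(1) have "f differentiable_on S"
    by (simp only: C_k_on.simps)
  with assms(2,3) show "f differentiable (at x)"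
    using differentiable_on_eq_differentiable_at by blast
qed

lemma has_real_derivative_along_line:
  fixes f :: "real^'q::finite \<Rightarrow> 'b::real_inner"
  assumes "C_k_on (Suc k) f S" "open S" "a + t *\<^sub>R h \<in> S"
  shows "((\<lambda>t. c \<bullet> f (a + t *\<^sub>R h)) has_real_derivative
           (\<Sum>j\<in>UNIV. h $ j * (c \<bullet> partial_deriv j f (a + t *\<^sub>R h)))) (at t)"
proof -
  have line: "((\<lambda>t. a + t *\<^sub>R h) has_derivative (\<lambda>s. s *\<^sub>R h)) (at t)"
    by (auto intro!: derivative_eq_intros)
  have "((\<lambda>t. f (a + t *\<^sub>R h)) has_derivative
          (\<lambda>s. \<Sum>j\<in>UNIV. (s *\<^sub>R h) $ j *\<^sub>R partial_deriv j f (a + t *\<^sub>R h))) (at t)"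
    by (rule has_derivative_compose[OF line C_k_on_SucD[OF assms]])
  then have D: "((\<lambda>t. c \<bullet> f (a + t *\<^sub>R h)) has_derivative
      (\<lambda>s. c \<bullet> (\<Sum>j\<in>UNIV. (s *\<^sub>R h) $ j *\<^sub>R partial_deriv j f (a + t *\<^sub>R h)))) (at t)"
    by (rule has_derivative_inner_right)
  show ?thesis
    by (rule has_derivative_imp_has_field_derivative[OF D])
      (simp add: inner_sum_right sum_distrib_left mult.assoc)
qed

lemma has_real_derivative_along_axis:
  fixes f :: "real^'q::finite \<Rightarrow> 'b::real_inner"
  assumes "C_k_on (Suc k) f S" "open S" "a + t *\<^sub>R axis j 1 \<in> S"
  shows "((\<lambda>t. c \<bullet> f (a + t *\<^sub>R axis j 1)) has_real_derivative
           (c \<bullet> partial_deriv j f (a + t *\<^sub>R axis j 1))) (at t)"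
proof -
  have "(\<Sum>i\<in>UNIV. axis j 1 $ i * (c \<bullet> partial_deriv i f (a + t *\<^sub>R axis j 1)))
      = (\<Sum>i\<in>UNIV. if i = j then c \<bullet> partial_deriv j f (a + t *\<^sub>R axis j 1) else 0)"
    by (rule sum.cong) (auto simp: axis_def)
  then show ?thesis
    using has_real_derivative_along_line[OF assms, of c] by simp
qed

text \<open>Two applications of the mean value theorem, first in direction \<open>j\<close> to the increment in direction
  \<open>l\<close>.  The left-hand side is symmetric in \<open>j\<close> and \<open>l\<close>, the right-hand side is a mixed partial
  derivative near \<open>x\<close>; this is how the order of differentiation becomes interchangeable.\<close>
lemma mixed_difference_mean_value:
  fixes f :: "real^'q::finite \<Rightarrow> 'b::real_inner"
  assumes f: "C_k_on 2 f S" and S: "open S" and s: "0 < s" "s < r"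
    and r: "ball x (2 * r) \<subseteq> S"
  obtains \<xi> where "\<xi> \<in> ball x (2 * r)"
    "c \<bullet> f (x + s *\<^sub>R axis j 1 + s *\<^sub>R axis l 1) - c \<bullet> f (x + s *\<^sub>R axis j 1)
       - c \<bullet> f (x + s *\<^sub>R axis l 1) + c \<bullet> f x
     = s\<^sup>2 * (c \<bullet> partial_deriv l (partial_deriv j f) \<xi>)"
proof -
  have f2: "C_k_on (Suc 1) f S" and fj: "C_k_on (Suc 0) (partial_deriv j f) S"
    using f by (simp_all add: numeral_2_eq_2)
  have near: "x + t *\<^sub>R axis j 1 + u *\<^sub>R axis l 1 \<in> ball x (2 * r)"
    if "0 \<le> t" "t \<le> s" "0 \<le> u" "u \<le> s" for t u
  proof -
    have "norm (t *\<^sub>R axis j 1 + u *\<^sub>R axis l (1::real)) \<le> t + u"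
      using that by (intro order.trans[OF norm_triangle_ineq]) (simp add: norm_axis_1)
    moreover have "t + u < 2 * r" using that s by linarith
    ultimately have "norm (t *\<^sub>R axis j 1 + u *\<^sub>R axis l (1::real)) < 2 * r"
      by (rule order.strict_trans1)
    moreover have "dist x (x + w) = norm w" for w
      by (simp add: dist_norm)
    ultimately show ?thesis
      by (simp only: mem_ball add.assoc)
  qed
  have near0: "x + t *\<^sub>R axis j 1 \<in> ball x (2 * r)" if "0 \<le> t" "t \<le> s" for t
    using near[OF that, of 0] s by simp
  define g where "g t = c \<bullet> f (x + s *\<^sub>R axis l 1 + t *\<^sub>R axis j 1) - c \<bullet> f (x + t *\<^sub>R axis j 1)" for t
  have "(g has_real_derivative (c \<bullet> partial_deriv j f (x + s *\<^sub>R axis l 1 + t *\<^sub>R axis j 1)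
          - c \<bullet> partial_deriv j f (x + t *\<^sub>R axis j 1))) (at t)" if "0 \<le> t" "t \<le> s" for t
    unfolding g_def
  proof (intro DERIV_diff has_real_derivative_along_axis[OF f2 S])
    show "x + s *\<^sub>R axis l 1 + t *\<^sub>R axis j 1 \<in> S"
      using near[OF that, of s] s r by (auto simp: algebra_simps)
    show "x + t *\<^sub>R axis j 1 \<in> S"
      using near0[OF that] r by auto
  qed
  from MVT2[OF s(1) this] obtain \<tau> where \<tau>: "0 < \<tau>" "\<tau> < s" and
    g: "g s - g 0 = s * (c \<bullet> partial_deriv j f (x + s *\<^sub>R axis l 1 + \<tau> *\<^sub>R axis j 1)
          - c \<bullet> partial_deriv j f (x + \<tau> *\<^sub>R axis j 1))"
    by auto
  have "((\<lambda>u. c \<bullet> partial_deriv j f (x + \<tau> *\<^sub>R axis j 1 + u *\<^sub>R axis l 1)) has_real_derivative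
      (c \<bullet> partial_deriv l (partial_deriv j f) (x + \<tau> *\<^sub>R axis j 1 + u *\<^sub>R axis l 1))) (at u)"
    if "0 \<le> u" "u \<le> s" for u
    using near[of \<tau> u] that \<tau> r by (intro has_real_derivative_along_axis[OF fj S]) auto
  from MVT2[OF s(1) this] obtain \<rho> where \<rho>: "0 < \<rho>" "\<rho> < s" and
    h: "c \<bullet> partial_deriv j f (x + \<tau> *\<^sub>R axis j 1 + s *\<^sub>R axis l 1)
        - c \<bullet> partial_deriv j f (x + \<tau> *\<^sub>R axis j 1)
      = s * (c \<bullet> partial_deriv l (partial_deriv j f) (x + \<tau> *\<^sub>R axis j 1 + \<rho> *\<^sub>R axis l 1))"
    by auto
  show thesis
  proof
    show "x + \<tau> *\<^sub>R axis j 1 + \<rho> *\<^sub>R axis l 1 \<in> ball x (2 * r)"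
      using near \<tau> \<rho> by simp
    show "c \<bullet> f (x + s *\<^sub>R axis j 1 + s *\<^sub>R axis l 1) - c \<bullet> f (x + s *\<^sub>R axis j 1)
       - c \<bullet> f (x + s *\<^sub>R axis l 1) + c \<bullet> f x
     = s\<^sup>2 * (c \<bullet> partial_deriv l (partial_deriv j f) (x + \<tau> *\<^sub>R axis j 1 + \<rho> *\<^sub>R axis l 1))"
      using g h by (simp add: g_def power2_eq_square algebra_simps)
  qed
qed

text \<open>If the two mixed derivatives differed at \<open>x\<close>, continuity would keep their components along the
  difference \<open>c\<close> on opposite sides of the midpoint \<open>m\<close> on a whole ball, whereas by
  \<open>mixed_difference_mean_value\<close> they share a value in every small ball around \<open>x\<close>.\<close>
lemma partial_deriv_commute:
  fixes f :: "real^'q::finite \<Rightarrow> 'b::real_inner"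
  assumes f: "C_k_on 2 f S" and S: "open S" "x \<in> S"
  shows "partial_deriv l (partial_deriv j f) x = partial_deriv j (partial_deriv l f) x"
proof (rule ccontr)
  let ?p = "partial_deriv l (partial_deriv j f)" and ?q = "partial_deriv j (partial_deriv l f)"
  assume ne: "?p x \<noteq> ?q x"
  define c where "c = ?p x - ?q x"
  have "continuous_on S ?p" "continuous_on S ?q"
    using f by (simp_all add: numeral_2_eq_2)
  then have contp: "continuous_on S (\<lambda>y. c \<bullet> ?p y)" and contq: "continuous_on S (\<lambda>y. c \<bullet> ?q y)"
    by (simp_all add: continuous_on_inner)
  have "c \<bullet> ?p x - c \<bullet> ?q x > 0"
    using ne unfolding c_def by (simp flip: inner_diff_right)
  define m where "m = (c \<bullet> ?p x + c \<bullet> ?q x) / 2"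
  have "open ((S \<inter> (\<lambda>y. c \<bullet> ?p y) -` {m<..}) \<inter> (S \<inter> (\<lambda>y. c \<bullet> ?q y) -` {..<m}))"
    (is "open ?N")
    by (intro open_Int continuous_open_preimage contp contq S(1) open_greaterThan open_lessThan)
  moreover have "x \<in> ?N"
    using S(2) \<open>c \<bullet> ?p x - c \<bullet> ?q x > 0\<close> by (simp add: m_def)
  ultimately obtain e where e: "e > 0" "ball x e \<subseteq> ?N"
    by (meson open_contains_ball)
  define r s where "r = e / 2" and "s = e / 4"
  have rs: "0 < s" "s < r" "ball x (2 * r) \<subseteq> ?N"
    using e by (auto simp: r_def s_def)
  then have rS: "ball x (2 * r) \<subseteq> S" by blast
  obtain \<xi> where \<xi>: "\<xi> \<in> ball x (2 * r)"
    "c \<bullet> f (x + s *\<^sub>R axis j 1 + s *\<^sub>R axis l 1) - c \<bullet> f (x + s *\<^sub>R axis j 1)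
       - c \<bullet> f (x + s *\<^sub>R axis l 1) + c \<bullet> f x = s\<^sup>2 * (c \<bullet> ?p \<xi>)"
    using mixed_difference_mean_value[OF f S(1) rs(1,2) rS] by blast
  obtain \<eta> where \<eta>: "\<eta> \<in> ball x (2 * r)"
    "c \<bullet> f (x + s *\<^sub>R axis l 1 + s *\<^sub>R axis j 1) - c \<bullet> f (x + s *\<^sub>R axis l 1)
       - c \<bullet> f (x + s *\<^sub>R axis j 1) + c \<bullet> f x = s\<^sup>2 * (c \<bullet> ?q \<eta>)"
    using mixed_difference_mean_value[OF f S(1) rs(1,2) rS] by blast
  have "s\<^sup>2 * (c \<bullet> ?p \<xi>) = s\<^sup>2 * (c \<bullet> ?q \<eta>)"
    using \<xi>(2) \<eta>(2) by (simp add: algebra_simps)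
  then have "c \<bullet> ?p \<xi> = c \<bullet> ?q \<eta>" using rs(1) by simp
  moreover have "c \<bullet> ?p \<xi> > m" "c \<bullet> ?q \<eta> < m"
    using subsetD[OF rs(3) \<xi>(1)] subsetD[OF rs(3) \<eta>(1)] by simp_all
  ultimately show False by simp
qed

text \<open>The one-dimensional theorem of Maclaurin is applied on the segment from \<open>a\<close> to \<open>a + h\<close>.  It needs a
  scalar function, and pairing \<open>f\<close> with the unit vector in the direction of the remainder itself makes
  the scalar estimate one for the full norm.  The constant comes from the compactness of the ball.\<close>
lemma taylor_order_two:
  fixes f :: "real^'q::finite \<Rightarrow> 'b::real_inner"
  assumes f: "C_k_on 3 f S" and S: "open S" "cball a r \<subseteq> S"
  obtains K where "0 \<le> K" "\<And>h. norm h \<le> r \<Longrightarrow>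
    norm (f (a + h) - f a - (\<Sum>j\<in>UNIV. h $ j *\<^sub>R partial_deriv j f a)
      - (1/2) *\<^sub>R (\<Sum>j\<in>UNIV. \<Sum>l\<in>UNIV. (h $ j * h $ l) *\<^sub>R partial_deriv l (partial_deriv j f) a))
    \<le> K * norm h ^ 3"
proof -
  let ?f1 = "\<lambda>j. partial_deriv j f"
  let ?f2 = "\<lambda>j l. partial_deriv l (partial_deriv j f)"
  let ?f3 = "\<lambda>j l k. partial_deriv k (partial_deriv l (partial_deriv j f))"
  have f0: "C_k_on (Suc 2) f S" and f1: "C_k_on (Suc 1) (?f1 j) S"
    and f2: "C_k_on (Suc 0) (?f2 j l) S" and f3: "continuous_on S (?f3 j l k)" for j l k
    using f by (simp_all add: eval_nat_numeral)
  have "continuous_on (cball a r) (\<lambda>x. \<Sum>j\<in>UNIV. \<Sum>l\<in>UNIV. \<Sum>k\<in>UNIV. norm (?f3 j l k x))"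
    by (intro continuous_intros continuous_on_subset[OF f3 S(2)])
  then have "bounded ((\<lambda>x. \<Sum>j\<in>UNIV. \<Sum>l\<in>UNIV. \<Sum>k\<in>UNIV. norm (?f3 j l k x)) ` cball a r)"
    by (intro compact_imp_bounded compact_continuous_image compact_cball)
  then obtain B where "B > 0"
    and "\<forall>y\<in>(\<lambda>x. \<Sum>j\<in>UNIV. \<Sum>l\<in>UNIV. \<Sum>k\<in>UNIV. norm (?f3 j l k x)) ` cball a r. norm y \<le> B"
    unfolding bounded_pos by blast
  then have B: "\<bar>\<Sum>j\<in>UNIV. \<Sum>l\<in>UNIV. \<Sum>k\<in>UNIV. norm (?f3 j l k x)\<bar> \<le> B" if "x \<in> cball a r" for x
    using that by (simp only: ball_simps real_norm_def)
  show thesis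
  proof
    show "0 \<le> B / 6" using \<open>B > 0\<close> by simp
    fix h :: "real^'q" assume h: "norm h \<le> r"
    define rem where "rem = f (a + h) - f a - (\<Sum>j\<in>UNIV. h $ j *\<^sub>R ?f1 j a)
      - (1/2) *\<^sub>R (\<Sum>j\<in>UNIV. \<Sum>l\<in>UNIV. (h $ j * h $ l) *\<^sub>R ?f2 j l a)"
    \<comment> \<open>a unit vector unless \<open>rem = 0\<close>, and always \<open>c \<bullet> rem = norm rem\<close>\<close>
    define c where "c = sgn rem"
    have seg: "a + t *\<^sub>R h \<in> cball a r" if "0 \<le> t" "t \<le> 1" for t
    proof -
      have "norm (t *\<^sub>R h) \<le> 1 * norm h"
        using that by (simp add: mult_left_le_one_le)
      then show ?thesis using h by (simp add: dist_norm)
    qed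
    have segS: "a + t *\<^sub>R h \<in> S" if "0 \<le> t" "t \<le> 1" for t
      using seg[OF that] S(2) by blast
    define d where "d m t =
      (if m = 0 then c \<bullet> f (a + t *\<^sub>R h)
       else if m = 1 then \<Sum>j\<in>UNIV. h $ j * (c \<bullet> ?f1 j (a + t *\<^sub>R h))
       else if m = 2 then \<Sum>j\<in>UNIV. h $ j * (\<Sum>l\<in>UNIV. h $ l * (c \<bullet> ?f2 j l (a + t *\<^sub>R h)))
       else \<Sum>j\<in>UNIV. h $ j * (\<Sum>l\<in>UNIV. h $ l * (\<Sum>k\<in>UNIV. h $ k * (c \<bullet> ?f3 j l k (a + t *\<^sub>R h)))))"
      for m :: nat and t
    have deriv: "(d m has_real_derivative d (Suc m) t) (at t)" if "m < 3" "0 \<le> t" "t \<le> 1" for m t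
    proof -
      have d0: "d 0 = (\<lambda>t. c \<bullet> f (a + t *\<^sub>R h))"
        and d1: "d (Suc 0) = (\<lambda>t. \<Sum>j\<in>UNIV. h $ j * (c \<bullet> ?f1 j (a + t *\<^sub>R h)))"
        and d2: "d 2 = (\<lambda>t. \<Sum>j\<in>UNIV. h $ j * (\<Sum>l\<in>UNIV. h $ l * (c \<bullet> ?f2 j l (a + t *\<^sub>R h))))"
        and d3: "d 3 = (\<lambda>t. \<Sum>j\<in>UNIV. h $ j * (\<Sum>l\<in>UNIV. h $ l *
               (\<Sum>k\<in>UNIV. h $ k * (c \<bullet> ?f3 j l k (a + t *\<^sub>R h)))))"
        by (simp_all add: d_def fun_eq_iff)
      have S': "a + t *\<^sub>R h \<in> S" using segS that by blast
      consider "m = 0" | "m = 1" | "m = 2" using \<open>m < 3\<close> by linarith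
      then show ?thesis
      proof cases
        case 1
        show ?thesis
          using has_real_derivative_along_line[OF f0 S(1) S', of c] by (simp add: 1 d0 d1)
      next
        case 2
        have "((\<lambda>t. \<Sum>j\<in>UNIV. h $ j * (c \<bullet> ?f1 j (a + t *\<^sub>R h))) has_real_derivative
            (\<Sum>j\<in>UNIV. h $ j * (\<Sum>l\<in>UNIV. h $ l * (c \<bullet> ?f2 j l (a + t *\<^sub>R h))))) (at t)"
          by (intro DERIV_sum DERIV_cmult has_real_derivative_along_line[OF f1 S(1) S'])
        then show ?thesis by (simp add: 2 d1 d2 flip: numeral_2_eq_2)
      next
        case 3
        have "((\<lambda>t. \<Sum>j\<in>UNIV. h $ j * (\<Sum>l\<in>UNIV. h $ l * (c \<bullet> ?f2 j l (a + t *\<^sub>R h)))) has_real_derivative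
            (\<Sum>j\<in>UNIV. h $ j * (\<Sum>l\<in>UNIV. h $ l *
               (\<Sum>k\<in>UNIV. h $ k * (c \<bullet> ?f3 j l k (a + t *\<^sub>R h)))))) (at t)"
          by (intro DERIV_sum DERIV_cmult has_real_derivative_along_line[OF f2 S(1) S'])
        then show ?thesis by (simp add: 3 d2 d3)
      qed
    qed
    have "\<exists>t::real. 0 < t \<and> t < 1 \<and>
        d 0 1 = (\<Sum>m<3. (d m 0 / fact m) * 1 ^ m) + (d 3 t / fact 3) * 1 ^ 3"
      by (rule Maclaurin) (use deriv in simp_all)
    then obtain t where t: "0 < t" "t < 1"
      and "d 0 1 = (\<Sum>m<3. (d m 0 / fact m) * 1 ^ m) + (d 3 t / fact 3) * 1 ^ 3"
      by blast
    then have mac: "d 0 1 = d 0 0 + d 1 0 + d 2 0 / 2 + d 3 t / 6"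
      by (simp add: eval_nat_numeral)
    have "c \<bullet> rem = d 0 1 - d 0 0 - d 1 0 - d 2 0 / 2"
    proof -
      have "d 1 0 = c \<bullet> (\<Sum>j\<in>UNIV. h $ j *\<^sub>R ?f1 j a)"
        and "d 2 0 = c \<bullet> (\<Sum>j\<in>UNIV. \<Sum>l\<in>UNIV. (h $ j * h $ l) *\<^sub>R ?f2 j l a)"
        by (simp_all add: d_def inner_sum_right sum_distrib_left mult.assoc)
      then show ?thesis
        by (simp add: d_def rem_def inner_diff_right)
    qed
    then have "c \<bullet> rem = d 3 t / 6"
      using mac by simp
    moreover have "c \<bullet> rem = norm rem"
    proof (cases "rem = 0")
      case False
      have "rem \<bullet> rem = norm rem * norm rem"
        by (metis dot_square_norm power2_eq_square)
      then show ?thesis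
        using False by (simp add: c_def sgn_div_norm)
    qed simp
    moreover have "\<bar>d 3 t\<bar> \<le> B * norm h ^ 3"
    proof -
      have bnd: "\<bar>h $ j * (h $ l * (h $ k * (c \<bullet> ?f3 j l k (a + t *\<^sub>R h))))\<bar>
          \<le> norm h ^ 3 * norm (?f3 j l k (a + t *\<^sub>R h))" for j l k
      proof -
        have "\<bar>c \<bullet> ?f3 j l k (a + t *\<^sub>R h)\<bar> \<le> norm c * norm (?f3 j l k (a + t *\<^sub>R h))"
          by (rule Cauchy_Schwarz_ineq2)
        also have "\<dots> \<le> 1 * norm (?f3 j l k (a + t *\<^sub>R h))"
          by (intro mult_right_mono) (simp_all add: c_def norm_sgn)
        finally have "\<bar>h $ j\<bar> * (\<bar>h $ l\<bar> * (\<bar>h $ k\<bar> * \<bar>c \<bullet> ?f3 j l k (a + t *\<^sub>R h)\<bar>))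
          \<le> norm h * (norm h * (norm h * norm (?f3 j l k (a + t *\<^sub>R h))))"
          by (intro mult_mono component_le_norm_cart) auto
        then show ?thesis by (simp add: abs_mult power3_eq_cube mult.assoc)
      qed
      have "\<bar>d 3 t\<bar> \<le> (\<Sum>j\<in>UNIV. \<Sum>l\<in>UNIV. \<Sum>k\<in>UNIV.
          \<bar>h $ j * (h $ l * (h $ k * (c \<bullet> ?f3 j l k (a + t *\<^sub>R h))))\<bar>)"
      proof -
        have "d 3 t = (\<Sum>j\<in>UNIV. \<Sum>l\<in>UNIV. \<Sum>k\<in>UNIV.
            h $ j * (h $ l * (h $ k * (c \<bullet> ?f3 j l k (a + t *\<^sub>R h)))))"
          by (simp add: d_def sum_distrib_left)
        then show ?thesis
          by (simp only:) (intro order.trans[OF sum_abs] sum_mono order.refl)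
      qed
      also have "\<dots> \<le> (\<Sum>j\<in>UNIV. \<Sum>l\<in>UNIV. \<Sum>k\<in>UNIV. norm h ^ 3 * norm (?f3 j l k (a + t *\<^sub>R h)))"
        by (intro sum_mono bnd)
      also have "\<dots> = norm h ^ 3 * (\<Sum>j\<in>UNIV. \<Sum>l\<in>UNIV. \<Sum>k\<in>UNIV. norm (?f3 j l k (a + t *\<^sub>R h)))"
        by (simp add: sum_distrib_left)
      also have "\<dots> \<le> norm h ^ 3 * B"
        using B[OF seg[of t]] t by (intro mult_left_mono) auto
      finally show ?thesis by (simp add: mult.commute)
    qed
    ultimately show "norm (f (a + h) - f a - (\<Sum>j\<in>UNIV. h $ j *\<^sub>R ?f1 j a)
      - (1/2) *\<^sub>R (\<Sum>j\<in>UNIV. \<Sum>l\<in>UNIV. (h $ j * h $ l) *\<^sub>R ?f2 j l a)) \<le> B / 6 * norm h ^ 3"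
      unfolding rem_def[symmetric] by simp
  qed
qed

section \<open>Ranges of leading singular vectors\<close>
lemma outer_mult_vec: "outer a b *v x = (b \<bullet> x) *\<^sub>R a"
  by (simp add: vec_eq_iff outer_def matrix_vector_mult_def inner_vec_def sum_distrib_right
      sum_distrib_left mult_ac)

lemma is_svd_mult_vec:
  fixes A :: "real^'s::finite^'n::finite"
  assumes "is_svd A u \<sigma> v"
  shows "A *v x = (\<Sum>k < min CARD('n) CARD('s). (\<sigma> k * (v k \<bullet> x)) *\<^sub>R u k)"
proof -
  have sum_mult: "(\<Sum>k\<in>K. B k) *v x = (\<Sum>k\<in>K. B k *v x)"
    if "finite K" for K :: "nat set" and B :: "nat \<Rightarrow> real^'s^'n"
    using that by induction (simp_all add: matrix_vector_mult_add_rdistrib)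
  have A: "A = (\<Sum>k < min CARD('n) CARD('s). \<sigma> k *\<^sub>R outer (u k) (v k))"
    using assms unfolding is_svd_def by blast
  show ?thesis
    by (subst A)
      (simp add: sum_mult outer_mult_vec flip: scaleR_matrix_vector_assoc)
qed

lemma card_below_less_CARD: "card {l. l < k} < CARD('r)" for k :: "'r::{finite,linorder}"
  by (rule psubset_card_mono) auto

lemma inj_card_below: "inj (\<lambda>k::'r::{finite,linorder}. card {l. l < k})"
proof (rule linorder_injI)
  fix k l :: 'r
  assume "k < l"
  then have "{i. i < k} \<subset> {i. i < l}" by auto
  then have "card {i. i < k} < card {i. i < l}" by (intro psubset_card_mono) auto
  then show "card {i. i < k} \<noteq> card {i. i < l}" by simp
qed

lemma transpose_mult_first_left_singular_vectors:
  fixes A :: "real^'s::finite^'n::finite" and W :: "real^('r::{finite,linorder})^'n"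
  assumes "first_left_singular_vectors A W"
  shows "transpose W ** W = mat 1"
proof -
  obtain u \<sigma> v where r: "CARD('r) \<le> CARD('n)" and svd: "is_svd A u \<sigma> v"
    and W: "\<And>k. column k W = u (card {l. l < k})"
    using assms unfolding first_left_singular_vectors_def by blast
  have u: "u k \<bullet> u l = (if k = l then 1 else 0)" if "k < CARD('n)" "l < CARD('n)" for k l
    using svd that unfolding is_svd_def orthonormal_family_def by blast
  have "column k W \<bullet> column l W = (if k = l then 1 else 0)" for k l
    unfolding W using u[of "card {i. i < k}" "card {i. i < l}"] r
      card_below_less_CARD[of k] card_below_less_CARD[of l] injD[OF inj_card_below, of k l]
    by auto
  then show ?thesis
    by (simp add: vec_eq_iff matrix_matrix_mult_def transpose_def mat_def inner_vec_def column_def)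
qed

text \<open>Singular values are listed in non-increasing order, so a vanishing one among the first
  \<open>CARD('r)\<close> would confine the range of \<open>A\<close> to the span of fewer than \<open>rank A\<close> vectors.  A left singular
  vector whose singular value is nonzero is an image under \<open>A\<close>, and the dimensions agree.\<close>
lemma range_first_left_singular_vectors:
  fixes A :: "real^'s::finite^'n::finite" and W :: "real^('r::{finite,linorder})^'n"
  assumes W: "first_left_singular_vectors A W" and rank: "rank A = CARD('r)"
  shows "range ((*v) W) = range ((*v) A)"
proof -
  obtain u \<sigma> v where svd: "is_svd A u \<sigma> v"
    and col: "\<And>k. column k W = u (card {l. l < k})"
    using W unfolding first_left_singular_vectors_def by blast
  let ?N = "min CARD('n) CARD('s)"
  have rN: "CARD('r) \<le> ?N"
    using rank_bound[of A] by (simp add: rank min.commute)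
  have nonneg: "0 \<le> \<sigma> k" if "k < ?N" for k
    using svd that unfolding is_svd_def by blast
  have decr: "\<sigma> l \<le> \<sigma> k" if "k \<le> l" "l < ?N" for k l
    using svd that unfolding is_svd_def by blast
  have v: "v k \<bullet> v l = (if k = l then 1 else 0)" if "k < CARD('s)" "l < CARD('s)" for k l
    using svd that unfolding is_svd_def orthonormal_family_def by blast
  have subsp: "subspace (range ((*v) A))" "subspace (range ((*v) W))"
    by (auto intro!: linear_subspace_image)
  have \<sigma>: "\<sigma> k \<noteq> 0" if "k < CARD('r)" for k
  proof
    assume "\<sigma> k = 0"
    then have zero: "\<sigma> l = 0" if "k \<le> l" "l < ?N" for l
      using decr[OF that] nonneg[OF that(2)] by simp
    have "A *v x \<in> span (u ` {..<k})" for x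
    proof -
      have "(\<sigma> i * (v i \<bullet> x)) *\<^sub>R u i \<in> span (u ` {..<k})" if "i < ?N" for i
        using zero[of i] that
        by (cases "i < k") (auto intro: span_scale span_base simp: span_zero)
      then show ?thesis
        unfolding is_svd_mult_vec[OF svd] by (intro span_sum) simp
    qed
    then have "dim (range ((*v) A)) \<le> card (u ` {..<k})"
      by (intro dim_le_card) auto
    also have "\<dots> \<le> k"
      using card_image_le[of "{..<k}" u] by simp
    finally show False
      using rank that by (simp add: rank_dim_range)
  qed
  have "column k W \<in> range ((*v) A)" for k
  proof -
    define i where "i = card {l. l < k}"
    have i: "i < CARD('r)" "i < ?N"
      using card_below_less_CARD[of k] rN by (simp_all add: i_def)
    have "A *v v i = (\<Sum>j < ?N. if j = i then \<sigma> i *\<^sub>R u i else 0)"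
      unfolding is_svd_mult_vec[OF svd]
      by (rule sum.cong) (use i v in auto)
    then have "A *v v i = \<sigma> i *\<^sub>R u i"
      using i(2) by simp
    then have "A *v ((1 / \<sigma> i) *\<^sub>R v i) = u i"
      using \<sigma>[OF i(1)] by (simp add: linear_scale[OF matrix_vector_mul_linear])
    then show ?thesis
      unfolding col i_def[symmetric] by (metis rangeI)
  qed
  then have sub: "range ((*v) W) \<subseteq> range ((*v) A)"
    by (auto simp: matrix_mult_sum[of W] scalar_mult_eq_scaleR intro!: subspace_sum subspace_scale subsp)
  have "inj ((*v) W)"
    using transpose_mult_first_left_singular_vectors[OF W]
    by (metis matrix_left_invertible_injective)
  then have "dim (range ((*v) W)) = CARD('r)"
    using full_rank_injective[of W] by (simp add: rank_dim_range)
  then show ?thesis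
    using subspace_dim_equal[OF subsp(2,1) sub] rank by (simp add: rank_dim_range)
qed

lemma range_mult_surj:
  fixes A :: "real^'k::finite^'n::finite" and B :: "real^'s::finite^'k"
  assumes "rank B = CARD('k)"
  shows "range ((*v) (A ** B)) = range ((*v) A)"
proof -
  have "surj ((*v) B)"
    using assms full_rank_surjective by blast
  moreover have "range ((*v) (A ** B)) = (*v) A ` range ((*v) B)"
    by (simp add: image_image matrix_vector_mul_assoc)
  ultimately show ?thesis by simp
qed

section \<open>Quadratic forms indexed by pairs\<close>
lemma sum_symidx:
  fixes g :: "'q::{finite,linorder} \<Rightarrow> 'q \<Rightarrow> 'b::comm_monoid_add"
  shows "(\<Sum>p\<in>UNIV. g (row_of p) (col_of p)) = (\<Sum>(j, l)\<in>{(j, l). j \<le> l}. g j l)"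
proof -
  have "bij_betw pair_of (UNIV :: 'q symidx set) {(j, l). j \<le> l}"
    unfolding bij_betw_def using type_definition.Rep_range[OF type_definition_symidx]
    by (auto intro!: injI simp: pair_of_inject)
  from sum.reindex_bij_betw[OF this, of "\<lambda>(j, l). g j l"] show ?thesis
    by (simp add: case_prod_beta)
qed

lemma symmetric_double_sum_eq_sum_symidx:
  fixes g :: "'q::{finite,linorder} \<Rightarrow> 'q \<Rightarrow> 'b::real_vector"
  assumes sym: "\<And>j l. g j l = g l j"
  shows "(\<Sum>j\<in>UNIV. \<Sum>l\<in>UNIV. g j l) = (\<Sum>p\<in>UNIV. sym_weight p *\<^sub>R g (row_of p) (col_of p))"
proof -
  let ?w = "\<lambda>j l :: 'q. 2 - (if j = l then 1 else 0 :: real)"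
  let ?up = "{(j, l :: 'q). j \<le> l}" and ?diag = "{(j, l :: 'q). j = l}" 
  let ?less = "{(j, l :: 'q). j < l}" and ?gt = "{(j, l :: 'q). l < j}"
  have up: "?up = ?less \<union> ?diag" by auto
  have UNIV: "(UNIV :: ('q \<times> 'q) set) = ?less \<union> ?diag \<union> ?gt" by auto
  have "(\<Sum>(j, l)\<in>?gt. g j l) = (\<Sum>(j, l)\<in>?less. g j l)"
    by (rule sum.reindex_bij_witness[where i = prod.swap and j = prod.swap]) (auto simp: sym)
  moreover have "(\<Sum>j\<in>UNIV. \<Sum>l\<in>UNIV. g j l) = (\<Sum>(j, l)\<in>UNIV. g j l)"
    by (simp add: sum.cartesian_product)
  moreover have "\<dots> = (\<Sum>(j, l)\<in>?less. g j l) + (\<Sum>(j, l)\<in>?diag. g j l) + (\<Sum>(j, l)\<in>?gt. g j l)"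
    unfolding UNIV by (subst sum.union_disjoint; auto)+
  moreover have "(\<Sum>p\<in>UNIV. sym_weight p *\<^sub>R g (row_of p) (col_of p)) = (\<Sum>(j, l)\<in>?up. ?w j l *\<^sub>R g j l)"
    unfolding sym_weight_def by (rule sum_symidx)
  moreover have "\<dots> = (\<Sum>(j, l)\<in>?less. ?w j l *\<^sub>R g j l) + (\<Sum>(j, l)\<in>?diag. ?w j l *\<^sub>R g j l)"
    unfolding up by (rule sum.union_disjoint) auto
  moreover have "(\<Sum>(j, l)\<in>?less. ?w j l *\<^sub>R g j l) = (\<Sum>(j, l)\<in>?less. 2 *\<^sub>R g j l)"
    by (rule sum.cong) auto
  moreover have "(\<Sum>(j, l)\<in>?less. 2 *\<^sub>R g j l) = 2 *\<^sub>R (\<Sum>(j, l)\<in>?less. g j l)"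
    by (simp add: scaleR_sum_right case_prod_beta)
  moreover have "(\<Sum>(j, l)\<in>?diag. ?w j l *\<^sub>R g j l) = (\<Sum>(j, l)\<in>?diag. g j l)"
    by (rule sum.cong) auto
  ultimately show ?thesis
    by (simp add: scaleR_2)
qed

lemma CARD_symidx: "CARD('q::{finite,linorder} symidx) = CARD('q) * (CARD('q) + 1) div 2"
proof -
  let ?up = "{(j, l :: 'q). j \<le> l}"
  have "CARD('q symidx) = card ?up"
    using sum_symidx[of "\<lambda>_ _ :: 'q. 1 :: nat"] by (simp add: case_prod_beta)
  moreover have "card ?up = card (prod.swap ` ?up)"
    by (rule card_image[symmetric]) simp
  moreover have "card ?up + card (prod.swap ` ?up) = card (?up \<union> prod.swap ` ?up) + card (?up \<inter> prod.swap ` ?up)"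
    by (rule card_Un_Int) auto
  moreover have "?up \<union> prod.swap ` ?up = UNIV"
    by (auto simp: image_iff) 
  moreover have "?up \<inter> prod.swap ` ?up = (\<lambda>j. (j, j)) ` UNIV"
    by auto
  moreover have "card ((\<lambda>j::'q. (j, j)) ` UNIV) = CARD('q)"
    by (rule card_image) (auto intro: injI)
  ultimately have "2 * CARD('q symidx) = CARD('q) * CARD('q) + CARD('q)"
    by (simp add: card_prod)
  then show ?thesis by simp
qed

lemma norm_vecsym_outer_diff_le:
  fixes x y :: "real^'q::{finite,linorder}"
  shows "norm (vecsym (outer x x) - vecsym (outer y y))
      \<le> real CARD('q symidx) * (norm (x - y) * (norm x + norm y))"
proof -
  have "\<bar>(vecsym (outer x x) - vecsym (outer y y)) $ p\<bar> \<le> norm (x - y) * (norm x + norm y)" for p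
  proof -
    let ?j = "row_of p" and ?l = "col_of p"
    have "(vecsym (outer x x) - vecsym (outer y y)) $ p = (x - y) $ ?j * x $ ?l + (x - y) $ ?l * y $ ?j"
      by (simp add: vecsym_def outer_def algebra_simps)
    also have "\<bar>\<dots>\<bar> \<le> \<bar>(x - y) $ ?j\<bar> * \<bar>x $ ?l\<bar> + \<bar>(x - y) $ ?l\<bar> * \<bar>y $ ?j\<bar>"
      by (rule order.trans[OF abs_triangle_ineq]) (simp add: abs_mult)
    also have "\<dots> \<le> norm (x - y) * norm x + norm (x - y) * norm y"
      by (intro add_mono mult_mono component_le_norm_cart) auto
    finally show ?thesis by (simp add: distrib_left)
  qed
  then have "(\<Sum>p\<in>UNIV. \<bar>(vecsym (outer x x) - vecsym (outer y y)) $ p\<bar>)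
      \<le> (\<Sum>p\<in>(UNIV :: 'q symidx set). norm (x - y) * (norm x + norm y))"
    by (rule sum_mono)
  with norm_le_l1_cart[of "vecsym (outer x x) - vecsym (outer y y)"] show ?thesis
    by simp
qed

text \<open>\<open>Qbase_mat U\<close> turns the vectorized \<open>h h\<^sup>T\<close> into the second differential of \<open>U\<close> at \<open>0\<close> applied to
  \<open>(h, h)\<close>; the weight \<open>2 - \<delta>\<close> accounts for the entries below the diagonal.\<close>
lemma Qbase_mat_mult_vecsym_outer:
  assumes "C_k_on 2 U S" "open S" "0 \<in> S"
  shows "Qbase_mat U *v vecsym (outer h h)
      = (\<Sum>j\<in>UNIV. \<Sum>l\<in>UNIV. (h $ j * h $ l) *\<^sub>R partial_deriv l (partial_deriv j U) 0)"
proof -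
  have "(\<Sum>j\<in>UNIV. \<Sum>l\<in>UNIV. (h $ j * h $ l) *\<^sub>R partial_deriv j (partial_deriv l U) 0)
      = (\<Sum>p\<in>UNIV. sym_weight p *\<^sub>R ((h $ row_of p * h $ col_of p) *\<^sub>R second_partial U p 0))"
    unfolding second_partial_def
    by (rule symmetric_double_sum_eq_sum_symidx) (simp add: partial_deriv_commute[OF assms] mult.commute)
  also have "\<dots> = Qbase_mat U *v vecsym (outer h h)"
    by (simp add: vec_eq_iff Qbase_mat_def matrix_vector_mult_def vecsym_def outer_def mult_ac)
  finally show ?thesis
    by (simp add: partial_deriv_commute[OF assms])
qed

lemma R_mat_eq: "R_mat U Pi0 U2 = (1/2) *\<^sub>R (transpose U2 ** ((mat 1 - Pi0) ** Qbase_mat U))"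
proof -
  have "(transpose U2 ** (M ** Qbase_mat U)) $ k $ p
      = sym_weight p * (column k U2 \<bullet> (M *v second_partial U p 0))" for M k p
    by (simp add: Qbase_mat_def matrix_matrix_mult_def matrix_vector_mult_def transpose_def
        column_def inner_vec_def sum_distrib_left mult_ac)
  then show ?thesis
    by (simp add: vec_eq_iff R_mat_def)
qed

section \<open>The normal part of the second derivatives\<close>
lemma normal_component_range:
  fixes W :: "real^'q::finite^'n::finite"
  assumes W: "transpose W ** W = mat 1"
  shows "normal_component (range ((*v) W)) x = (mat 1 - W ** transpose W) *v x"
  unfolding normal_component_def
proof (rule the_equality)
  let ?z = "(mat 1 - W ** transpose W) *v x"
  have ort: "orthogonal z t" if "transpose W *v z = 0" "t \<in> range ((*v) W)" for z t
    using that by (auto simp: orthogonal_def dot_lmul_matrix[symmetric] simp flip: transpose_matrix_vector)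
  have z: "transpose W *v ?z = 0"
    by (simp add: matrix_vector_mult_diff_rdistrib matrix_vector_mult_diff_distrib
        matrix_vector_mul_assoc matrix_mul_assoc W)
  have xz: "x - ?z = W *v (transpose W *v x)"
    by (simp add: matrix_vector_mult_diff_rdistrib matrix_vector_mul_assoc del: transpose_matrix_vector)
  show "(\<forall>t\<in>range ((*v) W). orthogonal ?z t) \<and> x - ?z \<in> range ((*v) W)"
    using ort[OF z] xz by simp
  fix y assume y: "(\<forall>t\<in>range ((*v) W). orthogonal y t) \<and> x - y \<in> range ((*v) W)"
  have "subspace (range ((*v) W))"
    by (auto intro!: linear_subspace_image)
  then have "(x - ?z) - (x - y) \<in> range ((*v) W)"
    by (rule subspace_diff) (use y in \<open>simp_all only: xz rangeI\<close>)
  then have "y - ?z \<in> range ((*v) W)" by simp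
  then have "orthogonal y (y - ?z)" "orthogonal ?z (y - ?z)"
    using y ort[OF z] by blast+
  then have "(y - ?z) \<bullet> (y - ?z) = 0"
    by (simp add: orthogonal_def inner_diff_left)
  then show "y = ?z" by simp
qed

text \<open>The weights \<open>2 - \<delta>\<close> are nonzero, so scaling by them does not shrink the span of the columns.\<close>
lemma rank_normal_Qbase_mat:
  fixes M :: "real^'n::finite^'n"
  shows "rank (M ** Qbase_mat U) \<ge> dim (range (\<lambda>p. M *v second_partial U p 0))"
proof -
  have "M *v second_partial U p 0 \<in> range ((*v) (M ** Qbase_mat U))" for p
  proof -
    have "sym_weight p \<noteq> 0" by (simp add: sym_weight_def)
    have "Qbase_mat U *v axis p 1 = column p (Qbase_mat U)"
      by (simp add: matrix_vector_mult_basis)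
    also have "\<dots> = sym_weight p *\<^sub>R second_partial U p 0"
      by (simp add: vec_eq_iff column_def Qbase_mat_def)
    finally have "(M ** Qbase_mat U) *v ((1 / sym_weight p) *\<^sub>R axis p 1) = M *v second_partial U p 0"
      using \<open>sym_weight p \<noteq> 0\<close>
      by (simp add: linear_scale[OF matrix_vector_mul_linear] flip: matrix_vector_mul_assoc)
    then show ?thesis by (metis rangeI)
  qed
  then show ?thesis
    unfolding rank_dim_range by (intro dim_subset) auto
qed

section \<open>Eliminating the parameter\<close>
lemma matrix_diff_ldistrib: "A ** (B - C) = A ** B - A ** C" for A :: "real^'b::finite^'a::finite"
  by (simp add: vec_eq_iff matrix_matrix_mult_def right_diff_distrib sum_subtractf)

lemma matrix_inv_mult_left:
  fixes A :: "real^'n::finite^'n"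
  assumes "invertible A"
  shows "matrix_inv A ** A = mat 1"
  using assms unfolding invertible_def matrix_inv_def by (rule someI2_ex) simp

text \<open>The map \<open>h \<mapsto> B (L (v h))\<close> recovers \<open>h\<close> up to second order because \<open>B L\<close> is a left inverse of the
  linear part \<open>J\<close>.  Since \<open>T\<close> annihilates \<open>J\<close>, the leading term of \<open>T (v h)\<close> is quadratic, and a relative
  perturbation of its argument of first order costs only a cubic error.  The error is expressed in
  terms of \<open>L (v h)\<close>, as \<open>norm h \<le> 2 * bB * norm (L (v h))\<close> once \<open>h\<close> is small enough to absorb the
  second-order defect.\<close>
lemma quadratic_closure:
  fixes v :: "real^('q::{finite,linorder}) \<Rightarrow> real^'n::finite"
    and J :: "real^('q::{finite,linorder})^'n" and G :: "real^('q symidx)^'n" and L :: "real^'n^'k::finite"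
    and B :: "real^'k^('q::{finite,linorder})" and T :: "real^'n^'m::finite"
  assumes r: "0 < r" and K: "0 \<le> K"
    and taylor: "\<And>h. norm h \<le> r \<Longrightarrow>
      norm (v h - J *v h - G *v vecsym (outer h h)) \<le> K * norm h ^ 3"
    and BLJ: "B ** (L ** J) = mat 1" and TJ: "T ** J = 0"
  shows "(\<lambda>h. norm (T *v v h - (T ** G) *v vecsym (outer (B *v (L *v v h)) (B *v (L *v v h)))))
      \<in> O[at 0](\<lambda>h. norm (L *v v h) ^ 3)"
proof -
  let ?s = "\<lambda>h :: real^('q::{finite,linorder}). vecsym (outer h h)"
  define N where "N = real CARD('q symidx)"
  define w where "w h = B *v (L *v v h)" for h
  obtain bG where bG: "0 < bG" "\<And>x. norm (G *v x) \<le> bG * norm x"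
    using linear_bounded_pos[OF matrix_vector_mul_linear[of G]] by blast
  obtain bB where bB: "0 < bB" "\<And>x. norm (B *v x) \<le> bB * norm x"
    using linear_bounded_pos[OF matrix_vector_mul_linear[of B]] by blast
  obtain bL where bL: "0 < bL" "\<And>x. norm (L *v x) \<le> bL * norm x"
    using linear_bounded_pos[OF matrix_vector_mul_linear[of L]] by blast
  obtain bT where bT: "0 < bT" "\<And>x. norm (T *v x) \<le> bT * norm x"
    using linear_bounded_pos[OF matrix_vector_mul_linear[of T]] by blast
  obtain bTG where bTG: "0 < bTG" "\<And>x. norm ((T ** G) *v x) \<le> bTG * norm x"
    using linear_bounded_pos[OF matrix_vector_mul_linear[of "T ** G"]] by blast
  define K1 where "K1 = bB * (bL * (K + bG * N))"
  define K2 where "K2 = bT * K + bTG * (N * (K1 * (2 + K1)))"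
  have N: "0 \<le> N" by (simp add: N_def)
  have K1: "0 \<le> K1" using K N bG bB bL by (simp add: K1_def)
  have K2: "0 \<le> K2" using K N bT bTG K1 by (simp add: K2_def)
  have diff_s: "norm (?s x - ?s y) \<le> N * (norm (x - y) * (norm x + norm y))" for x y
    unfolding N_def by (rule norm_vecsym_outer_diff_le)
  have w_near: "norm (w h - h) \<le> K1 * norm h ^ 2" if "norm h \<le> r" "norm h \<le> 1" for h
  proof -
    have "?s 0 = 0"
      by (simp add: vec_eq_iff vecsym_def outer_def)
    then have "norm (?s h) \<le> N * norm h ^ 2"
      using diff_s[of h 0] by (simp add: power2_eq_square)
    then have s: "norm (G *v ?s h) \<le> bG * (N * norm h ^ 2)"
      using bG by (meson mult_left_mono less_imp_le order.trans)
    have "norm (v h - J *v h) \<le> norm (v h - J *v h - G *v ?s h) + norm (G *v ?s h)"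
      using norm_triangle_ineq[of "v h - J *v h - G *v ?s h" "G *v ?s h"] by simp
    also have "\<dots> \<le> K * norm h ^ 3 + bG * (N * norm h ^ 2)"
      by (rule add_mono[OF taylor[OF that(1)] s])
    also have "\<dots> \<le> K * norm h ^ 2 + bG * (N * norm h ^ 2)"
      using K that(2) by (intro add_right_mono mult_left_mono power_decreasing) auto
    finally have first: "norm (v h - J *v h) \<le> (K + bG * N) * norm h ^ 2"
      by (simp add: algebra_simps)
    have "B *v (L *v (J *v h)) = h"
      by (simp add: matrix_vector_mul_assoc matrix_mul_assoc[symmetric] BLJ)
    then have "w h - h = B *v (L *v (v h - J *v h))"
      by (simp add: w_def matrix_vector_mult_diff_distrib)
    then have "norm (w h - h) \<le> bB * norm (L *v (v h - J *v h))"
      using bB by simp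
    also have "\<dots> \<le> bB * (bL * norm (v h - J *v h))"
      using bB bL by (intro mult_left_mono) auto
    also have "\<dots> \<le> bB * (bL * ((K + bG * N) * norm h ^ 2))"
      using bB bL first by (intro mult_left_mono) auto
    finally show ?thesis by (simp add: K1_def mult.assoc)
  qed
  have cubic: "norm (T *v v h - (T ** G) *v ?s (w h)) \<le> K2 * norm h ^ 3"
    if "norm h \<le> r" "norm h \<le> 1" for h
  proof -
    have "norm (w h) \<le> norm (w h - h) + norm h"
      using norm_triangle_ineq[of "w h - h" h] by simp
    also have "\<dots> \<le> K1 * norm h ^ 2 + norm h"
      using w_near[OF that] by simp
    also have "\<dots> \<le> K1 * norm h + norm h"
      using K1 that(2) power_decreasing[of 1 2 "norm h"] by (intro add_right_mono mult_left_mono) auto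
    finally have "norm h + norm (w h) \<le> (2 + K1) * norm h"
      by (simp add: algebra_simps)
    moreover have "norm (h - w h) \<le> K1 * norm h ^ 2"
      using w_near[OF that] by (simp add: norm_minus_commute)
    ultimately have "norm (h - w h) * (norm h + norm (w h)) \<le> (K1 * norm h ^ 2) * ((2 + K1) * norm h)"
      using K1 by (intro mult_mono) auto
    then have "N * (norm (h - w h) * (norm h + norm (w h))) \<le> N * ((K1 * norm h ^ 2) * ((2 + K1) * norm h))"
      using N by (rule mult_left_mono)
    with diff_s[of h "w h"]
    have "norm (?s h - ?s (w h)) \<le> N * ((K1 * norm h ^ 2) * ((2 + K1) * norm h))"
      by (rule order.trans)
    also have "\<dots> = N * (K1 * (2 + K1)) * norm h ^ 3"
      by (simp add: power2_eq_square power3_eq_cube)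
    finally have s: "norm (?s h - ?s (w h)) \<le> N * (K1 * (2 + K1)) * norm h ^ 3" .
    have "T *v (J *v h) = 0"
      by (simp add: matrix_vector_mul_assoc TJ)
    then have "T *v v h - (T ** G) *v ?s (w h)
        = T *v (v h - J *v h - G *v ?s h) + (T ** G) *v (?s h - ?s (w h))"
      by (simp add: matrix_vector_mult_diff_distrib matrix_vector_mul_assoc)
    also have "norm \<dots> \<le> bT * norm (v h - J *v h - G *v ?s h) + bTG * norm (?s h - ?s (w h))"
      by (intro order.trans[OF norm_triangle_ineq] add_mono bT bTG)
    also have "\<dots> \<le> bT * (K * norm h ^ 3) + bTG * (N * (K1 * (2 + K1)) * norm h ^ 3)"
      using taylor[OF that(1)] s bT bTG by (intro add_mono mult_left_mono) auto
    also have "\<dots> = K2 * norm h ^ 3"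
      by (simp add: K2_def algebra_simps)
    finally show ?thesis .
  qed
  \<comment> \<open>the last bound gives \<open>K1 * norm h \<le> 1 / 2\<close>, so that the defect in \<open>w_near\<close> is at most half of
    \<open>norm h\<close>\<close>
  define d where "d = min (min r 1) (1 / (2 * (K1 + 1)))"
  have d: "0 < d" using r K1 by (simp add: d_def)
  have bound: "norm (T *v v h - (T ** G) *v ?s (w h)) \<le> (K2 * (2 * bB) ^ 3) * norm (L *v v h) ^ 3"
    if "norm h < d" for h
  proof -
    have h: "norm h \<le> r" "norm h \<le> 1" "norm h \<le> 1 / (2 * (K1 + 1))"
      using that by (simp_all add: d_def)
    have "(K1 + 1) * norm h \<le> (K1 + 1) * (1 / (2 * (K1 + 1)))"
      using h(3) K1 by (intro mult_left_mono) auto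
    also have "\<dots> = 1 / 2" using K1 by simp
    finally have "K1 * norm h + norm h \<le> 1 / 2"
      by (simp only: distrib_right mult_1)
    then have "K1 * norm h \<le> 1 / 2"
      using norm_ge_zero[of h] by linarith
    then have "K1 * norm h * norm h \<le> 1 / 2 * norm h"
      by (rule mult_right_mono) simp
    moreover have "norm h \<le> norm (h - w h) + norm (w h)"
      using norm_triangle_ineq[of "h - w h" "w h"] by simp
    moreover have "norm (h - w h) \<le> K1 * norm h * norm h"
      using w_near[OF h(1,2)] by (simp add: norm_minus_commute power2_eq_square)
    moreover have "norm (w h) \<le> bB * norm (L *v v h)"
      unfolding w_def by (rule bB)
    ultimately have "norm h \<le> 2 * bB * norm (L *v v h)" by linarith
    then have "norm h ^ 3 \<le> (2 * bB * norm (L *v v h)) ^ 3"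
      by (rule power_mono) simp
    then have "K2 * norm h ^ 3 \<le> K2 * (2 * bB * norm (L *v v h)) ^ 3"
      using K2 by (rule mult_left_mono)
    with cubic[OF h(1,2)] show ?thesis
      by (simp add: power_mult_distrib mult.assoc)
  qed
  show ?thesis
  proof (rule bigoI)
    show "\<forall>\<^sub>F h in at 0. norm (norm (T *v v h - (T ** G) *v vecsym (outer (B *v (L *v v h)) (B *v (L *v v h)))))
        \<le> (K2 * (2 * bB) ^ 3) * norm (norm (L *v v h) ^ 3)"
      unfolding eventually_at using d bound unfolding w_def by (intro exI[of _ d]) simp
  qed
qed

theorem mainTheorem4:
  fixes S :: "(real^'n::finite) set"
    and ustar :: "real^'n"
    and Q0 :: "(real^('q::{finite,linorder})) set"
    and U :: "real^('q::{finite,linorder}) \<Rightarrow> real^'n"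
    and v :: "real^('q::{finite,linorder}) \<Rightarrow> real^'n"
    and \<nu>s :: "'s::finite \<Rightarrow> real^('q::{finite,linorder})"
    and U1 :: "real^('q::{finite,linorder})^'n"
    and U2 :: "real^('m::{finite,linorder})^'n"
    and Pi0 :: "real^'n^'n"
    and Q :: "real^'s^'n"
    and A :: "real^('q::{finite,linorder})^('q::{finite,linorder})"
    and R :: "real^('q symidx)^('m::{finite,linorder})"
    and \<alpha>1 :: "real^('q::{finite,linorder}) \<Rightarrow> real^('q::{finite,linorder})"
    and \<alpha>2 :: "real^('q::{finite,linorder}) \<Rightarrow> real^('m::{finite,linorder})"
  assumes m: "CARD('m) = CARD('q) * (CARD('q) + 1) div 2"
    and S: "embedded_submanifold 1 CARD('q) S" "ustar \<in> S"
    and Q0: "open Q0" "ball 0 1 \<subseteq> Q0"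
    and chart: "openin (top_of_set S) (U ` Q0)" "\<exists>V. homeomorphism Q0 (U ` Q0) U V"
      "U 0 = ustar"
    and v: "\<And>\<nu>. v \<nu> = U \<nu> - ustar"
    and smooth: "C_k_on 3 U Q0"
    and immersion: "\<And>\<nu>. \<nu> \<in> Q0 \<Longrightarrow> rank (jacobian U (at \<nu>)) = CARD('q)"
    and second_fundamental_form: "\<And>\<nu>. \<nu> \<in> Q0 \<Longrightarrow>
      dim (range (\<lambda>p. normal_component (range ((*v) (jacobian U (at \<nu>)))) (second_partial U p \<nu>)))
        = CARD('q) * (CARD('q) + 1) div 2"
    and samples: "\<And>i. \<nu>s i \<in> ball 0 1"
      "rank (P_mat \<nu>s) = CARD('q)" "rank (P2_mat \<nu>s) = CARD('m)"
    and U1: "first_left_singular_vectors (jacobian U (at 0) ** P_mat \<nu>s) U1"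
    and Pi0: "Pi0 = U1 ** transpose U1"
    and A: "A = transpose U1 ** jacobian U (at 0)"
    and Q: "Q = Qbase_mat U ** P2_mat \<nu>s"
    and U2: "first_left_singular_vectors ((mat 1 - Pi0) ** Q) U2"
    and R: "R = R_mat U Pi0 U2"
    and \<alpha>1: "\<And>\<nu>. \<alpha>1 \<nu> = transpose U1 *v v \<nu>"
    and \<alpha>2: "\<And>\<nu>. \<alpha>2 \<nu> = transpose U2 *v v \<nu>"
  shows "(\<lambda>\<nu>. norm (\<alpha>2 \<nu>
            - R *v vecsym (outer (matrix_inv A *v \<alpha>1 \<nu>) (matrix_inv A *v \<alpha>1 \<nu>))))
         \<in> O[at 0](\<lambda>\<nu>. norm (\<alpha>1 \<nu>) ^ 3)"
proof -
  let ?J = "jacobian U (at 0)" and ?N = "mat 1 - Pi0"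
  have zero: "0 \<in> Q0" using Q0(2) by auto
  have C2: "C_k_on 2 U Q0" 
    using smooth by (simp add: eval_nat_numeral differentiable_imp_continuous_on)
  have J: "?J *v h = (\<Sum>j\<in>UNIV. h $ j *\<^sub>R partial_deriv j U 0)" for h
  proof -
    have D: "(U has_derivative (\<lambda>h. \<Sum>j\<in>UNIV. h $ j *\<^sub>R partial_deriv j U 0)) (at 0)"
      using smooth Q0(1) zero by (intro C_k_on_SucD[of 2]) (simp_all only: eval_nat_numeral)
    then have "(U has_derivative (\<lambda>h. ?J *v h)) (at 0)"
      using jacobian_works differentiableI by blast
    from has_derivative_unique[OF this D] show ?thesis by (rule fun_cong)
  qed

  have U1_orth: "transpose U1 ** U1 = mat 1"
    by (rule transpose_mult_first_left_singular_vectors[OF U1])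
  have range_JP: "range ((*v) (?J ** P_mat \<nu>s)) = range ((*v) ?J)"
    by (rule range_mult_surj[OF samples(2)])
  then have "rank (?J ** P_mat \<nu>s) = CARD('q)"
    using immersion[OF zero] by (simp add: rank_dim_range)
  from range_first_left_singular_vectors[OF U1 this]
  have range_U1: "range ((*v) U1) = range ((*v) ?J)"
    unfolding range_JP .
  have U1_A: "U1 ** A = ?J"
  proof -
    have "U1 *v (A *v x) = ?J *v x" for x
    proof -
      have "?J *v x \<in> range ((*v) U1)"
        unfolding range_U1 by (rule rangeI)
      then obtain y where y: "?J *v x = U1 *v y" by blast
      have "A *v x = transpose U1 *v (?J *v x)"
        by (simp only: A matrix_vector_mul_assoc)
      also have "\<dots> = y"
        by (simp only: y matrix_vector_mul_assoc U1_orth matrix_vector_mul_lid)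
      finally show ?thesis using y by simp
    qed
    then show ?thesis
      by (simp add: matrix_eq matrix_vector_mul_assoc)
  qed
  have U1_N: "transpose U1 ** ?N = 0"
    unfolding Pi0 by (simp add: matrix_diff_ldistrib matrix_mul_assoc U1_orth)

  have "normal_component (range ((*v) ?J)) x = ?N *v x" for x
    unfolding range_U1[symmetric] Pi0 by (rule normal_component_range[OF U1_orth])
  then have "CARD('m) \<le> rank (?N ** Qbase_mat U)"
    using rank_normal_Qbase_mat[of ?N U] second_fundamental_form[OF zero] m by simp
  moreover have "rank (?N ** Qbase_mat U) \<le> CARD('q symidx)"
    using rank_bound[of "?N ** Qbase_mat U"] by simp
  ultimately have rank_NQ: "rank (?N ** Qbase_mat U) = CARD('m)"
    using CARD_symidx[where 'q = 'q] m by simp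
  have NQ: "range ((*v) (?N ** Q)) = range ((*v) (?N ** Qbase_mat U))"
    unfolding Q matrix_mul_assoc
    by (rule range_mult_surj) (use samples(3) m CARD_symidx[where 'q = 'q] in simp)
  then have "rank (?N ** Q) = CARD('m)"
    using rank_NQ by (simp add: rank_dim_range)
  from range_first_left_singular_vectors[OF U2 this]
  have range_U2: "range ((*v) U2) = range ((*v) (?N ** Q))" .
  have "transpose U1 *v (U2 *v y) = 0" for y
  proof -
    have "U2 *v y \<in> range ((*v) (?N ** Q))"
      unfolding range_U2[symmetric] by (rule rangeI)
    then obtain x where x: "U2 *v y = (?N ** Q) *v x" by blast
    show ?thesis
      by (simp only: x matrix_vector_mul_assoc matrix_mul_assoc U1_N) simp
  qed
  then have "transpose U1 ** U2 = 0"
    by (simp add: matrix_eq matrix_vector_mul_assoc del: transpose_matrix_vector)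
  then have U2_U1: "transpose U2 ** U1 = 0"
    using matrix_transpose_mul[of "transpose U1" U2] by (simp add: vec_eq_iff transpose_def)
  have U2_J: "transpose U2 ** ?J = 0"
    by (simp add: U2_U1 matrix_mul_assoc flip: U1_A)
  have "transpose U2 ** ?N = transpose U2"
    unfolding Pi0 by (simp add: matrix_diff_ldistrib matrix_mul_assoc U2_U1)
  then have R_eq: "R = transpose U2 ** ((1/2) *\<^sub>R Qbase_mat U)"
    unfolding R R_mat_eq by (simp add: matrix_mul_assoc matrix_scalar_ac scalar_matrix_assoc)

  have "inj ((*v) A)"
  proof (rule injI)
    fix x y assume "A *v x = A *v y"
    then have "?J *v x = ?J *v y"
      by (simp flip: U1_A matrix_vector_mul_assoc)
    then show "x = y"
      using immersion[OF zero] full_rank_injective[of ?J] by (simp add: inj_eq)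
  qed
  then have "invertible A"
    by (metis invertible_left_inverse matrix_left_invertible_injective)
  then have A_inv: "matrix_inv A ** (transpose U1 ** ?J) = mat 1"
    unfolding A[symmetric] by (rule matrix_inv_mult_left)

  have ball: "cball 0 (1/2) \<subseteq> Q0"
    using Q0(2) by auto
  obtain K where K: "0 \<le> K" and taylor: "\<And>h. norm h \<le> 1/2 \<Longrightarrow>
      norm (U (0 + h) - U 0 - (\<Sum>j\<in>UNIV. h $ j *\<^sub>R partial_deriv j U 0)
        - (1/2) *\<^sub>R (\<Sum>j\<in>UNIV. \<Sum>l\<in>UNIV. (h $ j * h $ l) *\<^sub>R partial_deriv l (partial_deriv j U) 0))
      \<le> K * norm h ^ 3"
    using taylor_order_two[OF smooth Q0(1) ball] by blast
  have expansion: "norm (v h - ?J *v h - ((1/2) *\<^sub>R Qbase_mat U) *v vecsym (outer h h)) \<le> K * norm h ^ 3"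
    if "norm h \<le> 1/2" for h
    using taylor[OF that]
    by (simp add: v chart(3) J Qbase_mat_mult_vecsym_outer[OF C2 Q0(1) zero]
        flip: scaleR_matrix_vector_assoc)
  have "(0::real) < 1/2" by simp
  from quadratic_closure[OF this K expansion A_inv U2_J] show ?thesis
    by (simp only: \<alpha>1 \<alpha>2 R_eq)
qed

end
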